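(* $\mathsf{OG\mapsto\alpha0}\leq_{\mathsf{W}}\mathsf{lim}$, where $\mathsf{OG\mapsto\alpha0}$ is the problem which, given a countable ordered group $(G,\leq)$ whose order type is $\mathbb{Z}^{\alpha}$ for some ordinal $\alpha$, outputs a copy of $\alpha$.
   Context: Weihrauch reducibility: a represented space is a set $X$ with a partial surjection $\delta_X:\subseteq\mathbb{N}^{\mathbb{N}}\to X$; if $\delta_X(p)=x$, $p$ is a name of $x$. A problem is a partial multi-valued function between represented spaces. $f\leq_{\mathsf{W}}g$ iff there are computable partial functions $\Phi,\Psi$ on Baire space such that whenever $p$ is a name of some $x\in\mathrm{dom}(f)$, $\Phi(p)$ is a name of some $z\in\mathrm{dom}(g)$, and for every name $q$ of an element of $g(z)$, $\Psi(p,q)$ is a name of an element of $f(x)$. Ordered groups: an ordered group is a group $G$ with a linear order $\leq$ such that $a\leq b$ implies $ag\leq bg$ and $ga\leq gb$ for all $g$. Countable ordered groups are presented on subsets of $\mathbb{N}$, a name coding the universe, operation and order. The order type of $G$ is a linear order $X$ such that there is an order-preserving bijection $G\to X$. $\mathbb{Z}^X$ is the set of finitely supported functions $X\to\mathbb{Z}$, where for $f\neq g$, $f<g$ iff $f(x)<g(x)$ at the maximum $x$ where they differ. A copy of an ordinal $\alpha$ is a pair $(A,<_A)$ with $A\subseteq\mathbb{N}$, $<_A\subseteq A\times A$ a well-order of $A$ isomorphic to $\alpha$, coded in Baire space. $\mathsf{lim}$: given a convergent sequence $(p_i)_{i\in\mathbb{N}}$ in $\mathbb{N}^{\mathbb{N}}$,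 output $\lim_{i\to\infty}p_i$. *)

theory Defs
  imports "HOL-Analysis.Function_Topology" "HOL-Algebra.Group" "HOL-Library.Nat_Bijection"
begin

type_synonym baire = "nat \<Rightarrow> nat"


section \<open>Computability on Baire space\<close>

text \<open>
  Programs for Kleene's partial recursive functions relative to an oracle \<open>p\<close>. Evaluation is
  undefined on argument lists of the wrong length. \<open>Prec\<close> recurses on the first argument.
\<close>

datatype prog =
    Zero | Succ | Oracle | Proj nat | Comp prog "prog list" | Prec prog prog | Mu prog

inductive evals :: "baire \<Rightarrow> prog \<Rightarrow> nat list \<Rightarrow> nat \<Rightarrow> bool" for p :: baire where
  "evals p Zero xs 0"
| "evals p Succ [x] (Suc x)"
| "evals p Oracle [x] (p x)"
| "i < length xs \<Longrightarrow> evals p (Proj i) xs (xs ! i)"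
| "list_all2 (\<lambda>g y. evals p g xs y) gs ys \<Longrightarrow> evals p f ys z \<Longrightarrow> evals p (Comp f gs) xs z"
| "evals p f xs z \<Longrightarrow> evals p (Prec f g) (0 # xs) z"
| "evals p (Prec f g) (n # xs) y \<Longrightarrow> evals p g (n # y # xs) z
    \<Longrightarrow> evals p (Prec f g) (Suc n # xs) z"
| "evals p f (n # xs) 0 \<Longrightarrow> (\<forall>m<n. \<exists>y. evals p f (m # xs) (Suc y)) \<Longrightarrow> evals p (Mu f) xs n"

inductive_cases evals_elims:
  "evals p Zero xs z" "evals p Succ xs z" "evals p Oracle xs z" "evals p (Proj i) xs z"
  "evals p (Comp f gs) xs z" "evals p (Prec f g) (0 # xs) z"
  "evals p (Prec f g) (Suc n # xs) z" "evals p (Mu f) xs z"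

lemma evals_deterministic: "evals p f xs y \<Longrightarrow> evals p f xs z \<Longrightarrow> y = z"
proof (induction arbitrary: z rule: evals.induct)
  case (5 xs gs ys f z')
  from "5.prems" obtain ys' where ys': "list_all2 (\<lambda>g y. evals p g xs y) gs ys'" "evals p f ys' z"
    by (auto elim: evals_elims)
  have "ys = ys'"
    using "5.IH"(1) ys'(1) by (auto simp: list_all2_conv_all_nth intro!: nth_equalityI)
  then show ?case using "5.IH"(2) ys'(2) by blast
next
  case (6 f xs z' g)
  then show ?case by (blast elim: evals_elims(6))
next
  case (7 f g n xs y z')
  then show ?case by (blast elim: evals_elims(7))
next
  case (8 f n xs)
  from "8.prems" have z: "evals p f (z # xs) 0" "\<forall>m<z. \<exists>y. evals p f (m # xs) (Suc y)"
    by (auto elim: evals_elims)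
  have "\<not> z < n" using z(1) "8.IH"(2) by fastforce
  moreover have "\<not> n < z" using z(2) "8.IH"(1) by fastforce
  ultimately show ?case by simp
qed (auto elim: evals_elims)

text \<open>
  A partial function on Baire space is computable if some program computes it on its domain. The
  program may converge on further inputs, so that computability passes to restrictions.
\<close>

definition computable :: "(baire \<rightharpoonup> baire) \<Rightarrow> bool" where
  "computable \<Phi> \<longleftrightarrow> (\<exists>e. \<forall>p q. \<Phi> p = Some q \<longrightarrow> (\<forall>n. evals p e [n] (q n)))"

definition baire_pair :: "baire \<Rightarrow> baire \<Rightarrow> baire" where
  "baire_pair p q n = (if even n then p (n div 2) else q (n div 2))"

definition computable2 :: "(baire \<times> baire \<rightharpoonup> baire) \<Rightarrow> bool" where
  "computable2 \<Psi> \<longleftrightarrow>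
    (\<exists>e. \<forall>p q r. \<Psi> (p, q) = Some r \<longrightarrow> (\<forall>n. evals (baire_pair p q) e [n] (r n)))"


section \<open>Problems and Weihrauch reducibility\<close>

text \<open>
  A represented space is given by its representation \<open>\<delta> :: baire \<rightharpoonup> 'a\<close>; its underlying set is
  \<open>ran \<delta>\<close>. In a problem \<open>f\<close>, \<open>solutions f x\<close> is the set \<open>f(x)\<close>, which is nonempty exactly when
  \<open>x\<close> is in the domain of \<open>f\<close>.
\<close>

record ('a, 'b) problem =
  in_rep :: "baire \<rightharpoonup> 'a"
  out_rep :: "baire \<rightharpoonup> 'b"
  solutions :: "'a \<Rightarrow> 'b set"

definition problem_dom :: "('a, 'b) problem \<Rightarrow> 'a set" where
  "problem_dom f = {x \<in> ran (in_rep f). solutions f x \<noteq> {}}"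

definition weihrauch_le :: "('a, 'b) problem \<Rightarrow> ('c, 'd) problem \<Rightarrow> bool"
    (infix "\<le>\<^sub>W" 50) where
  "f \<le>\<^sub>W g \<longleftrightarrow> (\<exists>\<Phi> \<Psi>. computable \<Phi> \<and> computable2 \<Psi> \<and>
    (\<forall>p x. in_rep f p = Some x \<and> x \<in> problem_dom f \<longrightarrow>
      (\<exists>p' z. \<Phi> p = Some p' \<and> in_rep g p' = Some z \<and> z \<in> problem_dom g \<and>
        (\<forall>q y. out_rep g q = Some y \<and> y \<in> solutions g z \<longrightarrow>
          (\<exists>r w. \<Psi> (p, q) = Some r \<and> out_rep f r = Some w \<and> w \<in> solutions f x)))))"


section \<open>The limit problem\<close>

definition lim_problem :: "(nat \<Rightarrow> baire, baire) problem" where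
  "lim_problem = \<lparr>
    in_rep = (\<lambda>p. Some (\<lambda>i n. p (prod_encode (i, n)))),
    out_rep = Some,
    solutions = (\<lambda>s. {l. s \<longlonglongrightarrow> l}) \<rparr>"


section \<open>Ordered groups\<close>

record 'a ogroup = "'a monoid" +
  gle :: "'a rel"

locale ordered_group = group G for G (structure) +
  assumes gle_linear_order: "linear_order_on (carrier G) (gle G)"
    and gle_mult: "(a, b) \<in> gle G \<Longrightarrow> g \<in> carrier G \<Longrightarrow>
      (a \<otimes> g, b \<otimes> g) \<in> gle G \<and> (g \<otimes> a, g \<otimes> b) \<in> gle G"

text \<open>
  A name of an ordered group on a set \<open>U\<close> of natural numbers is a join of the characteristic
  function of \<open>U\<close>, the characteristic function of the order, and the operation, whose values
  outside \<open>U \<times> U\<close> are arbitrary. For \<open>ogroup_rep\<close> to be single-valued, the operation of the named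
  structure is \<open>undefined\<close> outside \<open>U \<times> U\<close>. The unit is the unique idempotent.
\<close>

definition ogroup_decode :: "baire \<Rightarrow> nat ogroup" where
  "ogroup_decode p =
    (let U = {a. p (3 * a) = 1};
         m = (\<lambda>a b. if a \<in> U \<and> b \<in> U then p (3 * prod_encode (a, b) + 2) else undefined)
     in \<lparr> carrier = U, mult = m, one = (THE e. e \<in> U \<and> m e e = e),
          gle = {(a, b). p (3 * prod_encode (a, b) + 1) = 1} \<rparr>)"

definition ogroup_rep :: "baire \<rightharpoonup> nat ogroup" where
  "ogroup_rep p =
    (if (\<forall>n. p (3 * n) \<in> {0, 1} \<and> p (3 * n + 1) \<in> {0, 1}) \<and> ordered_group (ogroup_decode p)
     then Some (ogroup_decode p) else None)"


section \<open>Order types\<close>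

text \<open>
  Linear orders \<open>r\<close> are reflexive relations with underlying set \<open>Field r\<close>; ordinals are given by
  the library's \<open>Well_order\<close> relations up to \<open>ordIso\<close>.
\<close>

definition int_power :: "'a rel \<Rightarrow> ('a \<Rightarrow> int) set" where
  "int_power r = {f. finite {x. f x \<noteq> 0} \<and> {x. f x \<noteq> 0} \<subseteq> Field r}"

definition int_power_less :: "'a rel \<Rightarrow> ('a \<Rightarrow> int) \<Rightarrow> ('a \<Rightarrow> int) \<Rightarrow> bool" where
  "int_power_less r f g \<longleftrightarrow> (\<exists>x. (\<forall>y. f y \<noteq> g y \<longrightarrow> (y, x) \<in> r) \<and> f x < g x)"

definition has_order_type_int_power :: "('b, 'm) ogroup_scheme \<Rightarrow> 'a rel \<Rightarrow> bool" where
  "has_order_type_int_power G r \<longleftrightarrow>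
    (\<exists>h. bij_betw h (carrier G) (int_power r) \<and>
      (\<forall>a\<in>carrier G. \<forall>b\<in>carrier G.
        (a, b) \<in> gle G \<longleftrightarrow> h a = h b \<or> int_power_less r (h a) (h b)))"


section \<open>Copies of ordinals\<close>

definition strict_well_order :: "nat set \<times> nat rel \<Rightarrow> bool" where
  "strict_well_order = (\<lambda>(A, R). R \<subseteq> A \<times> A \<and> strict_linear_order_on A R \<and> wf R)"

definition is_copy :: "nat set \<times> nat rel \<Rightarrow> 'a rel \<Rightarrow> bool" where
  "is_copy C \<alpha> \<longleftrightarrow> strict_well_order C \<and> (case C of (A, R) \<Rightarrow> (R \<union> Id_on A, \<alpha>) \<in> ordIso)"

definition copy_decode :: "baire \<Rightarrow> nat set \<times> nat rel" where
  "copy_decode p = ({a. p (2 * a) = 1}, {(a, b). p (2 * prod_encode (a, b) + 1) = 1})"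

definition copy_rep :: "baire \<rightharpoonup> nat set \<times> nat rel" where
  "copy_rep p =
    (if (\<forall>n. p n \<in> {0, 1}) \<and> strict_well_order (copy_decode p)
     then Some (copy_decode p) else None)"


section \<open>From ordered groups to ordinals\<close>

text \<open>
  It suffices to let \<open>\<alpha>\<close> range over well-orders on sets of natural numbers, by
  \<open>countable_exponent\<close> below.
\<close>

definition OG_to_alpha0 :: "(nat ogroup, nat set \<times> nat rel) problem" where
  "OG_to_alpha0 = \<lparr>
    in_rep = ogroup_rep,
    out_rep = copy_rep,
    solutions = (\<lambda>G. {C. \<exists>\<alpha> :: nat rel.
      Well_order \<alpha> \<and> has_order_type_int_power G \<alpha> \<and> is_copy C \<alpha>}) \<rparr>"

lemma countable_exponent:
  fixes G :: "(nat, 'm) ogroup_scheme" and \<alpha> :: "'a rel"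
  assumes "Well_order \<alpha>" and "has_order_type_int_power G \<alpha>"
  shows "\<exists>\<beta> :: nat rel. Well_order \<beta> \<and> (\<alpha>, \<beta>) \<in> ordIso \<and> has_order_type_int_power G \<beta>"
proof -
  obtain h where h: "bij_betw h (carrier G) (int_power \<alpha>)"
    and hle: "\<And>a b. a \<in> carrier G \<Longrightarrow> b \<in> carrier G \<Longrightarrow>
      (a, b) \<in> gle G \<longleftrightarrow> h a = h b \<or> int_power_less \<alpha> (h a) (h b)"
    using assms(2) unfolding has_order_type_int_power_def by blast
  define u :: "'a \<Rightarrow> 'a \<Rightarrow> int" where "u x = (\<lambda>y. if y = x then 1 else 0)" for x
  define k where "k x = inv_into (carrier G) h (u x)" for x
  have u: "u x \<in> int_power \<alpha>" if "x \<in> Field \<alpha>" for x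
    using that by (auto simp: u_def int_power_def)
  have hk: "h (k x) = u x" if "x \<in> Field \<alpha>" for x
    using u[OF that] h by (simp add: k_def bij_betw_inv_into_right)
  have inj: "inj_on k (Field \<alpha>)"
  proof (rule inj_onI)
    fix x y assume "x \<in> Field \<alpha>" "y \<in> Field \<alpha>" "k x = k y"
    then have "u x x = u y x" using hk by metis
    then show "x = y" by (simp add: u_def split: if_splits)
  qed
  define \<beta> where "\<beta> = dir_image \<alpha> k"
  have F: "Field \<beta> = k ` Field \<alpha>" unfolding \<beta>_def by (rule dir_image_Field)
  define t :: "('a \<Rightarrow> int) \<Rightarrow> nat \<Rightarrow> int" where
    "t f n = (if n \<in> Field \<beta> then f (inv_into (Field \<alpha>) k n) else 0)" for f n
  have tk: "t f (k x) = f x" if "x \<in> Field \<alpha>" for f x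
    using that inj by (simp add: t_def F)
  have t0: "t f n = 0" if "n \<notin> Field \<beta>" for f n using that by (simp add: t_def)
  have "bij_betw t (int_power \<alpha>) (int_power \<beta>)"
  proof (rule bij_betwI[where g = "\<lambda>g x. if x \<in> Field \<alpha> then g (k x) else 0"])
    show "t \<in> int_power \<alpha> \<rightarrow> int_power \<beta>"
    proof
      fix f assume f: "f \<in> int_power \<alpha>"
      have "{n. t f n \<noteq> 0} \<subseteq> k ` {x. f x \<noteq> 0}"
      proof
        fix n assume n: "n \<in> {n. t f n \<noteq> 0}"
        then have "n \<in> Field \<beta>" using t0 by auto
        then obtain x where "x \<in> Field \<alpha>" "n = k x" using F by auto
        then show "n \<in> k ` {x. f x \<noteq> 0}" using n tk by auto
      qed
      then have "finite {n. t f n \<noteq> 0}"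
        using f finite_surj unfolding int_power_def by blast
      then show "t f \<in> int_power \<beta>" using t0 by (auto simp: int_power_def)
    qed
    show "(\<lambda>g x. if x \<in> Field \<alpha> then g (k x) else 0) \<in> int_power \<beta> \<rightarrow> int_power \<alpha>"
    proof
      fix g assume g: "g \<in> int_power \<beta>"
      have "{x. (if x \<in> Field \<alpha> then g (k x) else 0) \<noteq> 0} = {x \<in> Field \<alpha>. k x \<in> {n. g n \<noteq> 0}}"
        by auto
      moreover have "finite {x \<in> Field \<alpha>. k x \<in> {n. g n \<noteq> 0}}"
        using finite_vimage_IntI[OF _ inj, of "{n. g n \<noteq> 0}"] g
        by (simp add: int_power_def vimage_def Int_def conj_commute)
      ultimately show "(\<lambda>x. if x \<in> Field \<alpha> then g (k x) else 0) \<in> int_power \<alpha>"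
        by (auto simp: int_power_def split: if_splits)
    qed
    show "(\<lambda>x. if x \<in> Field \<alpha> then t f (k x) else 0) = f" if "f \<in> int_power \<alpha>" for f
      using that tk by (auto simp: int_power_def fun_eq_iff)
    show "t (\<lambda>x. if x \<in> Field \<alpha> then g (k x) else 0) = g" if g: "g \<in> int_power \<beta>" for g
    proof
      fix n
      show "t (\<lambda>x. if x \<in> Field \<alpha> then g (k x) else 0) n = g n"
      proof (cases "n \<in> Field \<beta>")
        case True
        then obtain x where "x \<in> Field \<alpha>" "n = k x" using F by auto
        then show ?thesis by (simp add: tk)
      next
        case False
        then show ?thesis using g t0 by (auto simp: int_power_def)
      qed
    qed
  qed
  then have bij: "bij_betw (t \<circ> h) (carrier G) (int_power \<beta>)"
    using h bij_betw_trans by blast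
  have less: "int_power_less \<beta> (t f) (t g) \<longleftrightarrow> int_power_less \<alpha> f g"
    if f: "f \<in> int_power \<alpha>" and g: "g \<in> int_power \<alpha>" for f g
  proof -
    have kr: "(k y, k x) \<in> \<beta> \<longleftrightarrow> (y, x) \<in> \<alpha>" if "y \<in> Field \<alpha>" "x \<in> Field \<alpha>" for x y
    proof
      assume "(k y, k x) \<in> \<beta>"
      then obtain a b where ab: "(a, b) \<in> \<alpha>" "k y = k a" "k x = k b"
        unfolding \<beta>_def dir_image_def by auto
      then have "a \<in> Field \<alpha>" "b \<in> Field \<alpha>" by (auto simp: Field_def)
      then show "(y, x) \<in> \<alpha>" using ab inj that by (auto dest: inj_onD)
    qed (auto simp: \<beta>_def dir_image_def)
    have F\<alpha>: "f y = g y" if "y \<notin> Field \<alpha>" for y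
    proof -
      have "f y = 0" "g y = 0" using f g that by (auto simp: int_power_def)
      then show ?thesis by simp
    qed
    have "int_power_less \<beta> (t f) (t g) \<longleftrightarrow>
        (\<exists>x\<in>Field \<beta>. (\<forall>y\<in>Field \<beta>. t f y \<noteq> t g y \<longrightarrow> (y, x) \<in> \<beta>) \<and> t f x < t g x)"
      unfolding int_power_less_def using t0 by (metis less_irrefl)
    also have "\<dots> \<longleftrightarrow> (\<exists>x\<in>Field \<alpha>. (\<forall>y\<in>Field \<alpha>. f y \<noteq> g y \<longrightarrow> (y, x) \<in> \<alpha>) \<and> f x < g x)"
      unfolding F by (simp add: tk kr cong: ball_cong bex_cong)
    also have "\<dots> \<longleftrightarrow> int_power_less \<alpha> f g"
      unfolding int_power_less_def using F\<alpha> by (metis less_irrefl)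
    finally show ?thesis .
  qed
  have t_inj: "t f = t g \<longleftrightarrow> f = g" if "f \<in> int_power \<alpha>" "g \<in> int_power \<alpha>" for f g
    using \<open>bij_betw t _ _\<close> that by (auto simp: bij_betw_def dest: inj_onD)
  have hmem: "h a \<in> int_power \<alpha>" if "a \<in> carrier G" for a using h that by (auto simp: bij_betw_def)
  have "has_order_type_int_power G \<beta>"
    unfolding has_order_type_int_power_def
    using bij hle less t_inj hmem by (intro exI[of _ "t \<circ> h"]) auto
  moreover have "Well_order \<beta>" unfolding \<beta>_def using assms(1) inj by (rule Well_order_dir_image)
  moreover have "(\<alpha>, \<beta>) \<in> ordIso" unfolding \<beta>_def using assms(1) inj by (rule dir_image_ordIso)
  ultimately show ?thesis by blast
qed

text \<open>Every ordered group on a set of natural numbers has a name, and every strict well-order too.\<close>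

lemma ogroup_rep_surj:
  fixes G :: "nat ogroup"
  assumes "ordered_group G"
    and undef: "\<And>a b. \<not> (a \<in> carrier G \<and> b \<in> carrier G) \<Longrightarrow> mult G a b = undefined"
  shows "G \<in> ran ogroup_rep"
proof -
  interpret ordered_group G by fact
  define p :: baire where "p n =
    (if n mod 3 = 0 then of_bool (n div 3 \<in> carrier G)
     else if n mod 3 = 1 then of_bool (prod_decode (n div 3) \<in> gle G)
     else (case prod_decode (n div 3) of (a, b) \<Rightarrow> mult G a b))" for n
  have p0: "p (3 * n) = of_bool (n \<in> carrier G)" for n by (simp add: p_def)
  have p1: "p (3 * n + 1) = of_bool (prod_decode n \<in> gle G)" for n
  proof -
    have "(3 * n + 1) mod 3 = 1" "(3 * n + 1) div 3 = n" by presburger+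
    then show ?thesis by (simp only: p_def) simp
  qed
  have p2: "p (3 * n + 2) = (case prod_decode n of (a, b) \<Rightarrow> mult G a b)" for n
  proof -
    have "(3 * n + 2) mod 3 = 2" "(3 * n + 2) div 3 = n" by presburger+
    then show ?thesis by (simp only: p_def) simp
  qed
  have c: "{a. p (3 * a) = 1} = carrier G" by (simp add: p0)
  have m: "(\<lambda>a b. if a \<in> carrier G \<and> b \<in> carrier G
      then p (3 * prod_encode (a, b) + 2) else undefined) = mult G"
    using undef by (intro ext) (simp del: One_nat_def add: p2 del: add_2_eq_Suc')
  have l: "{(a, b). p (3 * prod_encode (a, b) + 1) = 1} = gle G"
    unfolding p1 by simp
  have e: "(THE e. e \<in> carrier G \<and> mult G e e = e) = one G"
    by (rule the_equality) (use l_cancel_one in auto)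
  have "ogroup_decode p =
      \<lparr> carrier = carrier G, mult = mult G, one = one G, gle = gle G \<rparr>"
    using e unfolding ogroup_decode_def Let_def m[THEN fun_cong, THEN fun_cong, symmetric]
    by (simp only: c l mem_Collect_eq m)
  then have "ogroup_decode p = G" by simp
  moreover from this have "ogroup_rep p = Some G"
    using assms(1) by (auto simp: ogroup_rep_def p0 p1[simplified])
  ultimately show ?thesis by (auto simp: ran_def)
qed

lemma copy_rep_surj:
  assumes "strict_well_order C"
  shows "C \<in> ran copy_rep"
proof -
  obtain A R where C: "C = (A, R)" by (cases C)
  define p :: baire where "p n =
    (if even n then of_bool (n div 2 \<in> A) else of_bool (prod_decode (n div 2) \<in> R))" for n
  have "copy_decode p = C" by (auto simp: copy_decode_def p_def C)
  moreover from this have "copy_rep p = Some C"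
    using assms by (auto simp: copy_rep_def p_def)
  ultimately show ?thesis by (auto simp: ran_def)
qed

lemma solutions_subset:
  "solutions OG_to_alpha0 G \<subseteq> ran (out_rep OG_to_alpha0)"
  "solutions lim_problem s \<subseteq> ran (out_rep lim_problem)"
  using copy_rep_surj by (auto simp: OG_to_alpha0_def lim_problem_def is_copy_def ran_def)

end

theory Submission
  imports Defs
begin

text \<open>
  If \<open>G\<close> has order type \<open>\<int>\<^sup>\<alpha>\<close>, then \<open>\<alpha>\<close> is the order type of the set of archimedean classes of positive
  elements of \<open>G\<close>: the class of \<open>a\<close> corresponds to the largest coordinate in which \<open>a\<close> differs from
  the unit. This holds although the order isomorphism need not respect the group operation, since
  ``the largest difference of \<open>a\<close> and \<open>b\<close> is at most \<open>x\<close>'' can be expressed by the order alone, by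
  recursion on \<open>x\<close>, and so is invariant under translations. Hence the successive powers of \<open>a\<close> differ
  in the same coordinate.

  For positive \<open>a\<close> and \<open>b\<close>, the class of \<open>a\<close> is below that of \<open>b\<close> iff all powers of \<open>a\<close> are at most
  \<open>b\<close>. Testing only the \<open>i\<close>-th power gives approximations that decrease with \<open>i\<close>, so a single limit
  decides this relation, and with it which numbers are the least representatives of their classes.
\<close>

section \<open>Total functions computable uniformly in the oracle\<close>

definition ocomp :: "nat \<Rightarrow> (baire \<Rightarrow> nat list \<Rightarrow> nat) \<Rightarrow> bool" where
  "ocomp k F \<longleftrightarrow> (\<exists>e. \<forall>p xs. length xs = k \<longrightarrow> evals p e xs (F p xs))"

abbreviation odec :: "nat \<Rightarrow> (baire \<Rightarrow> nat list \<Rightarrow> bool) \<Rightarrow> bool" where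
  "odec k P \<equiv> ocomp k (\<lambda>p xs. of_bool (P p xs))"

lemma ocomp_cong:
  assumes "ocomp k F" and "\<And>p xs. length xs = k \<Longrightarrow> F p xs = G p xs"
  shows "ocomp k G"
  using assms by (auto simp: ocomp_def)

lemma ocomp_nth: "i < k \<Longrightarrow> ocomp k (\<lambda>p xs. xs ! i)"
  unfolding ocomp_def by (metis evals.intros(4))

lemma ocomp_compose:
  assumes G: "ocomp (length Fs) G" and Fs: "\<And>F. F \<in> set Fs \<Longrightarrow> ocomp k F"
  shows "ocomp k (\<lambda>p xs. G p (map (\<lambda>F. F p xs) Fs))"
proof -
  obtain e where e: "\<And>p xs. length xs = length Fs \<Longrightarrow> evals p e xs (G p xs)"
    using G by (auto simp: ocomp_def)
  have "\<forall>F\<in>set Fs. \<exists>e. \<forall>p xs. length xs = k \<longrightarrow> evals p e xs (F p xs)"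
    using Fs by (auto simp: ocomp_def)
  then obtain d where d: "\<And>F p xs. F \<in> set Fs \<Longrightarrow> length xs = k \<Longrightarrow> evals p (d F) xs (F p xs)"
    by metis
  have "evals p (Comp e (map d Fs)) xs (G p (map (\<lambda>F. F p xs) Fs))" if "length xs = k" for p xs
    by (rule evals.intros(5)[where ys = "map (\<lambda>F. F p xs) Fs"])
      (auto simp: list_all2_conv_all_nth e d that)
  then show ?thesis unfolding ocomp_def by blast
qed

lemma ocomp_app1:
  assumes "ocomp 1 (\<lambda>p xs. g p (xs ! 0))" "ocomp k F"
  shows "ocomp k (\<lambda>p xs. g p (F p xs))"
  using ocomp_compose[of "[F]" "\<lambda>p xs. g p (xs ! 0)" k] assms by simp

lemma ocomp_Suc: "ocomp k F \<Longrightarrow> ocomp k (\<lambda>p xs. Suc (F p xs))"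
proof (rule ocomp_app1[of "\<lambda>_. Suc"])
  have "evals p Succ xs (Suc (xs ! 0))" if "length xs = 1" for p xs
    using that evals.intros(2)[of p "xs ! 0"] by (cases xs) auto
  then show "ocomp 1 (\<lambda>p xs. Suc (xs ! 0))" unfolding ocomp_def by blast
qed

lemma ocomp_oracle: "ocomp k F \<Longrightarrow> ocomp k (\<lambda>p xs. p (F p xs))"
proof (rule ocomp_app1[of "\<lambda>p. p"])
  have "evals p Oracle xs (p (xs ! 0))" if "length xs = 1" for p xs
    using that evals.intros(3)[of p "xs ! 0"] by (cases xs) auto
  then show "ocomp 1 (\<lambda>p xs. p (xs ! 0))" unfolding ocomp_def by blast
qed

lemma ocomp_const: "ocomp k (\<lambda>p xs. c)"
proof (induction c)
  case 0
  then show ?case unfolding ocomp_def using evals.intros(1) by blast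
qed (rule ocomp_Suc)

lemma ocomp_rec_nat:
  assumes F: "ocomp k F" and G: "ocomp (k + 2) (\<lambda>p ys. G p (ys ! 0) (ys ! 1) (drop 2 ys))"
    and N: "ocomp k N"
  shows "ocomp k (\<lambda>p xs. rec_nat (F p xs) (\<lambda>n y. G p n y xs) (N p xs))"
proof -
  obtain f where f: "\<And>p xs. length xs = k \<Longrightarrow> evals p f xs (F p xs)"
    using F by (auto simp: ocomp_def)
  obtain g where g: "\<And>p ys. length ys = k + 2 \<Longrightarrow> evals p g ys (G p (ys ! 0) (ys ! 1) (drop 2 ys))"
    using G by (auto simp: ocomp_def)
  have *: "evals p (Prec f g) (n # xs) (rec_nat (F p xs) (\<lambda>n y. G p n y xs) n)"
    if "length xs = k" for p xs n
  proof (induction n)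
    case 0
    show ?case using f[OF that] by (auto intro: evals.intros)
  next
    case (Suc n)
    define y where "y = rec_nat (F p xs) (\<lambda>n y. G p n y xs) n"
    have "evals p g (n # y # xs) (G p n y xs)"
      using g[of "n # y # xs" p] that by simp
    then show ?case using Suc by (auto intro: evals.intros simp: y_def)
  qed
  have "ocomp (Suc k) (\<lambda>p ys. rec_nat (F p (tl ys)) (\<lambda>n y. G p n y (tl ys)) (ys ! 0))"
    unfolding ocomp_def
  proof (intro exI allI impI)
    fix p :: baire and ys :: "nat list" assume "length ys = Suc k"
    then show "evals p (Prec f g) ys (rec_nat (F p (tl ys)) (\<lambda>n y. G p n y (tl ys)) (ys ! 0))"
      using *[of "tl ys" p "ys ! 0"] by (cases ys) auto
  qed
  then have "ocomp k (\<lambda>p xs. (\<lambda>p ys. rec_nat (F p (tl ys)) (\<lambda>n y. G p n y (tl ys)) (ys ! 0)) p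
      (map (\<lambda>F. F p xs) (N # map (\<lambda>i p xs. xs ! i) [0..<k])))"
    by (intro ocomp_compose) (auto intro: N ocomp_nth)
  then show ?thesis
  proof (rule ocomp_cong)
    fix p :: baire and xs :: "nat list" assume "length xs = k"
    then have xs: "map (\<lambda>F. F p xs) (map (\<lambda>i p xs. xs ! i) [0..<k]) = xs"
      by (auto intro: nth_equalityI)
    show "(\<lambda>p ys. rec_nat (F p (tl ys)) (\<lambda>n y. G p n y (tl ys)) (ys ! 0)) p
      (map (\<lambda>F. F p xs) (N # map (\<lambda>i p xs. xs ! i) [0..<k])) =
      rec_nat (F p xs) (\<lambda>n y. G p n y xs) (N p xs)"
      by (simp only: list.map list.sel xs nth_Cons_0)
  qed
qed

lemma ocomp_drop:
  assumes "ocomp k F"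
  shows "ocomp (k + j) (\<lambda>p ys. F p (drop j ys))"
proof -
  have "ocomp (k + j) (\<lambda>p ys. F p (map (\<lambda>F. F p ys) (map (\<lambda>i p ys. ys ! (j + i)) [0..<k])))"
    using assms by (intro ocomp_compose) (auto intro: ocomp_nth)
  then show ?thesis
  proof (rule ocomp_cong)
    fix p :: baire and ys :: "nat list" assume "length ys = k + j"
    then have "map (\<lambda>F. F p ys) (map (\<lambda>i p ys. ys ! (j + i)) [0..<k]) = drop j ys"
      by (auto intro: nth_equalityI)
    then show "F p (map (\<lambda>F. F p ys) (map (\<lambda>i p ys. ys ! (j + i)) [0..<k])) = F p (drop j ys)"
      by simp
  qed
qed

lemma ocomp_add:
  assumes "ocomp k F" "ocomp k G"
  shows "ocomp k (\<lambda>p xs. F p xs + G p xs)"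
proof -
  have "rec_nat b (\<lambda>_ y. Suc y) a = a + b" for a b by (induction a) auto
  moreover have "ocomp k (\<lambda>p xs. rec_nat (G p xs) (\<lambda>_ y. Suc y) (F p xs))"
    by (intro ocomp_rec_nat assms ocomp_Suc ocomp_nth) simp
  ultimately show ?thesis by simp
qed

lemma ocomp_diff:
  assumes "ocomp k F" "ocomp k G"
  shows "ocomp k (\<lambda>p xs. F p xs - G p xs)"
proof -
  have "rec_nat 0 (\<lambda>n _. n) a = a - 1" for a :: nat by (cases a) auto
  moreover have "ocomp 1 (\<lambda>p xs. rec_nat 0 (\<lambda>n _. n) (xs ! 0))"
    by (intro ocomp_rec_nat ocomp_const ocomp_nth) simp_all
  ultimately have pred: "ocomp 1 (\<lambda>p xs. xs ! 0 - 1)" by simp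
  have "rec_nat a (\<lambda>_ y. y - 1) b = a - b" for a b :: nat by (induction b) auto
  moreover have "ocomp k (\<lambda>p xs. rec_nat (F p xs) (\<lambda>_ y. y - 1) (G p xs))"
    by (intro ocomp_rec_nat assms ocomp_app1[OF pred] ocomp_nth) simp
  ultimately show ?thesis by simp
qed

lemma ocomp_mult:
  assumes "ocomp k F" "ocomp k G"
  shows "ocomp k (\<lambda>p xs. F p xs * G p xs)"
proof -
  have "rec_nat 0 (\<lambda>_ y. y + b) a = a * b" for a b :: nat by (induction a) auto
  moreover have "ocomp k (\<lambda>p xs. rec_nat 0 (\<lambda>_ y. y + G p xs) (F p xs))"
    by (intro ocomp_rec_nat assms ocomp_add ocomp_const ocomp_nth ocomp_drop) simp
  ultimately show ?thesis by simp
qed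

lemma odec_not:
  assumes "odec k P"
  shows "odec k (\<lambda>p xs. \<not> P p xs)"
proof -
  have "1 - of_bool b = (of_bool (\<not> b) :: nat)" for b by simp
  then show ?thesis using ocomp_diff[OF ocomp_const[of _ 1] assms] by presburger
qed

lemma odec_conj:
  assumes "odec k P" "odec k Q"
  shows "odec k (\<lambda>p xs. P p xs \<and> Q p xs)"
  using ocomp_mult[OF assms] by (simp add: of_bool_conj)

lemma odec_disj:
  assumes "odec k P" "odec k Q"
  shows "odec k (\<lambda>p xs. P p xs \<or> Q p xs)"
  using odec_not[OF odec_conj[OF assms[THEN odec_not]]] by simp

lemma odec_imp:
  assumes "odec k P" "odec k Q"
  shows "odec k (\<lambda>p xs. P p xs \<longrightarrow> Q p xs)"
  unfolding imp_conv_disj by (intro odec_disj odec_not assms)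

lemma odec_if:
  assumes "odec k R" "odec k P" "odec k Q"
  shows "odec k (\<lambda>p xs. if R p xs then P p xs else Q p xs)"
  unfolding if_bool_eq_conj by (intro odec_conj odec_imp odec_not assms)

lemma odec_le:
  assumes "ocomp k F" "ocomp k G"
  shows "odec k (\<lambda>p xs. F p xs \<le> G p xs)"
proof -
  have "1 - (a - b) = of_bool (a \<le> b)" for a b :: nat by auto
  then show ?thesis using ocomp_diff[OF ocomp_const[of _ 1] ocomp_diff[OF assms]] by simp
qed

lemma odec_eq:
  assumes "ocomp k F" "ocomp k G"
  shows "odec k (\<lambda>p xs. F p xs = G p xs)"
  using odec_conj[OF odec_le[OF assms] odec_le[OF assms(2,1)]] by (simp add: eq_iff)

lemma odec_all_less:
  assumes P: "odec (k + 2) (\<lambda>p ys. P p (ys ! 0) (drop 2 ys))" and N: "ocomp k N"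
  shows "odec k (\<lambda>p xs. \<forall>j<N p xs. P p j xs)"
proof -
  have "rec_nat (1::nat) (\<lambda>n y. y * of_bool (P p n xs)) m = of_bool (\<forall>j<m. P p j xs)" for p xs m
    by (induction m) (auto simp: less_Suc_eq)
  moreover have "ocomp k (\<lambda>p xs. rec_nat 1 (\<lambda>n y. y * of_bool (P p n xs)) (N p xs))"
    by (intro ocomp_rec_nat P N ocomp_mult ocomp_const ocomp_nth) simp
  ultimately show ?thesis by simp
qed

lemma odec_even:
  assumes "ocomp k F"
  shows "odec k (\<lambda>p xs. even (F p xs))"
proof -
  have "rec_nat (1::nat) (\<lambda>_ y. 1 - y) a = of_bool (even a)" for a by (induction a) auto
  moreover have "ocomp k (\<lambda>p xs. rec_nat 1 (\<lambda>_ y. 1 - y) (F p xs))"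
    by (intro ocomp_rec_nat assms ocomp_diff ocomp_const ocomp_nth) simp
  ultimately show ?thesis by simp
qed

lemma ocomp_half:
  assumes "ocomp k F"
  shows "ocomp k (\<lambda>p xs. F p xs div 2)"
proof -
  have "rec_nat 0 (\<lambda>n y. y + of_bool (\<not> even n)) a = a div 2" for a :: nat
    by (induction a) auto
  moreover have "ocomp k (\<lambda>p xs. rec_nat 0 (\<lambda>n y. y + of_bool (\<not> even n)) (F p xs))"
    by (intro ocomp_rec_nat assms ocomp_add odec_not odec_even ocomp_const ocomp_nth) simp_all
  ultimately show ?thesis by simp
qed

lemma ocomp_triangle: "ocomp k F \<Longrightarrow> ocomp k (\<lambda>p xs. triangle (F p xs))"
  unfolding triangle_def by (intro ocomp_half ocomp_mult ocomp_Suc)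

lemma ocomp_prod_encode:
  assumes "ocomp k F" "ocomp k G"
  shows "ocomp k (\<lambda>p xs. prod_encode (F p xs, G p xs))"
  using assms by (auto simp: prod_encode_def intro!: ocomp_add ocomp_triangle)

lemma prod_decode_computation:
  fixes n :: nat
  defines "s \<equiv> rec_nat 0 (\<lambda>m y. y + of_bool (triangle (Suc y) = Suc m)) n"
  shows "fst (prod_decode n) = n - triangle s" "snd (prod_decode n) = s - (n - triangle s)"
proof -
  obtain a b where ab: "prod_decode n = (a, b)" by fastforce
  then have n: "n = triangle (a + b) + a"
    using prod_decode_inverse[of n] by (simp add: prod_encode_def)
  have s: "triangle s \<le> n \<and> n < triangle (Suc s)"
  proof -
    have step: "triangle y' \<le> Suc m \<and> Suc m < triangle (Suc y')"
      if "triangle y \<le> m \<and> m < triangle (Suc y)" "y' = y + of_bool (triangle (Suc y) = Suc m)"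
      for y y' m :: nat
      using that by (cases "triangle (Suc y) = Suc m") auto
    show ?thesis
      unfolding s_def
    proof (induction n)
      case (Suc m)
      show ?case by (rule step[OF Suc]) simp
    qed simp
  qed
  have mono: "triangle i \<le> triangle j" if "i \<le> j" for i j
    using that by (induction rule: dec_induct) auto
  have "s = a + b"
  proof (rule antisym)
    show "s \<le> a + b" using mono[of "Suc (a + b)" s] s n
      by (intro leI notI) (simp add: Suc_le_eq)
    show "a + b \<le> s" using mono[of "Suc s" "a + b"] s n
      by (intro leI notI) (simp add: Suc_le_eq)
  qed
  then show "fst (prod_decode n) = n - triangle s" "snd (prod_decode n) = s - (n - triangle s)"
    using n ab by simp_all
qed

lemma ocomp_prod_decode:
  assumes "ocomp k F"
  shows ocomp_fst_prod_decode: "ocomp k (\<lambda>p xs. fst (prod_decode (F p xs)))"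
    and ocomp_snd_prod_decode: "ocomp k (\<lambda>p xs. snd (prod_decode (F p xs)))"
  unfolding prod_decode_computation
  by (intro ocomp_rec_nat ocomp_add ocomp_diff ocomp_triangle odec_eq ocomp_Suc ocomp_const
      ocomp_nth assms; simp)+

lemmas ocomp_intros = ocomp_nth ocomp_Suc ocomp_oracle ocomp_const ocomp_rec_nat
  ocomp_add ocomp_diff ocomp_mult odec_not odec_conj odec_disj odec_imp odec_if odec_le odec_eq
  odec_all_less odec_even ocomp_half ocomp_prod_encode ocomp_fst_prod_decode ocomp_snd_prod_decode


section \<open>The approximation computed from a name\<close>

definition el :: "baire \<Rightarrow> nat \<Rightarrow> bool" where
  "el p a \<longleftrightarrow> p (3 * a) = 1"

definition leq :: "baire \<Rightarrow> nat \<Rightarrow> nat \<Rightarrow> bool" where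
  "leq p a b \<longleftrightarrow> p (3 * prod_encode (a, b) + 1) = 1"

definition mul :: "baire \<Rightarrow> nat \<Rightarrow> nat \<Rightarrow> nat" where
  "mul p a b = p (3 * prod_encode (a, b) + 2)"

text \<open>In an ordered group \<open>1 < a\<close> iff \<open>a < a a\<close>, so that the unit need not be found.\<close>

definition pos :: "baire \<Rightarrow> nat \<Rightarrow> bool" where
  "pos p a \<longleftrightarrow> el p a \<and> leq p a (mul p a a) \<and> mul p a a \<noteq> a"

text \<open>\<open>pow p a i\<close> is the power \<open>a\<^sup>i\<^sup>+\<^sup>1\<close>, which again avoids the unit.\<close>

definition pow :: "baire \<Rightarrow> nat \<Rightarrow> nat \<Rightarrow> nat" where
  "pow p a i = rec_nat a (\<lambda>_ y. mul p y a) i"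

definition below :: "baire \<Rightarrow> nat \<Rightarrow> nat \<Rightarrow> nat \<Rightarrow> bool" where
  "below p i a b \<longleftrightarrow> leq p (pow p a i) b"

definition least_rep :: "baire \<Rightarrow> (nat \<Rightarrow> nat \<Rightarrow> bool) \<Rightarrow> nat \<Rightarrow> bool" where
  "least_rep p B a \<longleftrightarrow> pos p a \<and> (\<forall>b<a. pos p b \<longrightarrow> B a b \<or> B b a)"

definition stage :: "baire \<Rightarrow> (nat \<Rightarrow> nat \<Rightarrow> bool) \<Rightarrow> baire" where
  "stage p B n = of_bool (if even n then least_rep p B (n div 2)
     else least_rep p B (fst (prod_decode (n div 2))) \<and> least_rep p B (snd (prod_decode (n div 2)))
       \<and> B (fst (prod_decode (n div 2))) (snd (prod_decode (n div 2))))"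

lemma odec_leq: "ocomp k F \<Longrightarrow> ocomp k G \<Longrightarrow> odec k (\<lambda>p xs. leq p (F p xs) (G p xs))"
  unfolding leq_def by (intro ocomp_intros)

lemma ocomp_mul: "ocomp k F \<Longrightarrow> ocomp k G \<Longrightarrow> ocomp k (\<lambda>p xs. mul p (F p xs) (G p xs))"
  unfolding mul_def by (intro ocomp_intros)

lemma ocomp_pow: "ocomp k F \<Longrightarrow> ocomp k G \<Longrightarrow> ocomp k (\<lambda>p xs. pow p (F p xs) (G p xs))"
  unfolding pow_def by (intro ocomp_rec_nat ocomp_mul ocomp_nth ocomp_drop) simp_all

lemma odec_pos: "ocomp k F \<Longrightarrow> odec k (\<lambda>p xs. pos p (F p xs))"
  unfolding pos_def el_def by (intro ocomp_intros odec_leq ocomp_mul)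

lemma odec_below:
  "ocomp k I \<Longrightarrow> ocomp k F \<Longrightarrow> ocomp k G \<Longrightarrow> odec k (\<lambda>p xs. below p (I p xs) (F p xs) (G p xs))"
  unfolding below_def by (intro odec_leq ocomp_pow)

lemma odec_least_rep:
  "ocomp k I \<Longrightarrow> ocomp k F \<Longrightarrow> odec k (\<lambda>p xs. least_rep p (below p (I p xs)) (F p xs))"
  unfolding least_rep_def
  by (intro odec_conj odec_pos odec_all_less odec_imp odec_disj odec_below ocomp_nth ocomp_drop)
    simp_all

lemma ocomp_stage: "ocomp k I \<Longrightarrow> ocomp k F \<Longrightarrow> ocomp k (\<lambda>p xs. stage p (below p (I p xs)) (F p xs))"
  unfolding stage_def by (intro ocomp_intros odec_least_rep odec_below)

lemma computable_Some:
  assumes "ocomp 1 (\<lambda>p xs. F p (xs ! 0))"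
  shows "computable (\<lambda>p. Some (F p))"
  proof -
  obtain e where "\<And>p xs. length xs = 1 \<Longrightarrow> evals p e xs (F p (xs ! 0))"
    using assms by (auto simp: ocomp_def)
  from this[of "[_]"] show ?thesis unfolding computable_def by auto
qed

lemma computable_stages:
  "computable (\<lambda>p. Some (\<lambda>m.
    stage p (below p (fst (prod_decode m))) (snd (prod_decode m))))"
  by (intro computable_Some ocomp_stage ocomp_prod_decode ocomp_nth) simp_all

lemma computable2_snd: "computable2 (\<lambda>(p, q). Some q)"
proof -
  have "ocomp 1 (\<lambda>p xs. p (2 * xs ! 0 + 1))" by (intro ocomp_intros) simp
  then obtain e where e: "\<And>p xs. length xs = 1 \<Longrightarrow> evals p e xs (p (2 * xs ! 0 + 1))"
    by (auto simp: ocomp_def)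
  have "evals (baire_pair p q) e [n] (q n)" for p q n
    using e[of "[n]" "baire_pair p q"] by (simp add: baire_pair_def)
  then show ?thesis unfolding computable2_def by auto
qed

section \<open>Ordered groups of order type a power of the integers\<close>

context ordered_group
begin

lemma
  shows gle_trans: "(a, b) \<in> gle G \<Longrightarrow> (b, c) \<in> gle G \<Longrightarrow> (a, c) \<in> gle G"
    and gle_antisym: "(a, b) \<in> gle G \<Longrightarrow> (b, a) \<in> gle G \<Longrightarrow> a = b"
    and gle_carrier: "(a, b) \<in> gle G \<Longrightarrow> a \<in> carrier G \<and> b \<in> carrier G"
  using gle_linear_order unfolding order_on_defs by (auto dest: transD antisymD)

lemma gle_mult_left_iff:
  assumes "a \<in> carrier G" "b \<in> carrier G" "g \<in> carrier G"
  shows "(g \<otimes> a, g \<otimes> b) \<in> gle G \<longleftrightarrow> (a, b) \<in> gle G"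
  using gle_mult[of "g \<otimes> a" "g \<otimes> b" "inv g"] gle_mult[of a b g] assms
  by (auto simp: m_assoc[symmetric])

end

locale int_power_group = ordered_group G for G (structure) +
  fixes r :: "'c rel" and h
  assumes Well_order_r: "Well_order r"
    and bij_h: "bij_betw h (carrier G) (int_power r)"
    and gle_iff: "a \<in> carrier G \<Longrightarrow> b \<in> carrier G \<Longrightarrow>
      (a, b) \<in> gle G \<longleftrightarrow> h a = h b \<or> int_power_less r (h a) (h b)"
begin

lemma
  shows r_refl: "x \<in> Field r \<Longrightarrow> (x, x) \<in> r"
    and r_trans: "(x, y) \<in> r \<Longrightarrow> (y, z) \<in> r \<Longrightarrow> (x, z) \<in> r"
    and r_antisym: "(x, y) \<in> r \<Longrightarrow> (y, x) \<in> r \<Longrightarrow> x = y"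
    and r_total: "x \<in> Field r \<Longrightarrow> y \<in> Field r \<Longrightarrow> (x, y) \<in> r \<or> (y, x) \<in> r"
    and r_wf: "wf (r - Id)"
  using Well_order_r unfolding order_on_defs well_order_on_def
  by (auto simp: refl_on_def total_on_def dest: transD antisymD) metis+

lemma h_finite: "a \<in> carrier G \<Longrightarrow> finite {x. h a x \<noteq> 0}"
  and h_outside: "a \<in> carrier G \<Longrightarrow> x \<notin> Field r \<Longrightarrow> h a x = 0"
  using bij_h by (auto simp: bij_betw_def int_power_def)

lemma h_inj: "a \<in> carrier G \<Longrightarrow> b \<in> carrier G \<Longrightarrow> h a = h b \<longleftrightarrow> a = b"
  using bij_h by (auto simp: bij_betw_def dest: inj_onD)

lemma h_update:
  assumes "a \<in> carrier G" "x \<in> Field r"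
  shows "\<exists>c\<in>carrier G. h c = (h a)(x := v)"
proof -
  have "{y. ((h a)(x := v)) y \<noteq> 0} \<subseteq> insert x {y. h a y \<noteq> 0}" by auto
  then have "finite {y. ((h a)(x := v)) y \<noteq> 0}"
    using h_finite[OF assms(1)] by (meson finite.insertI finite_subset)
  then have "(h a)(x := v) \<in> int_power r"
    using h_outside[OF assms(1)] assms(2) by (auto simp: int_power_def)
  then show ?thesis using bij_h unfolding bij_betw_def by (metis image_iff)
qed

definition agree_above :: "'c \<Rightarrow> 'a \<Rightarrow> 'a \<Rightarrow> bool" where
  "agree_above x a b \<longleftrightarrow> (\<forall>y. (x, y) \<in> r \<and> y \<noteq> x \<longrightarrow> h a y = h b y)"

definition agree_from :: "'c \<Rightarrow> 'a \<Rightarrow> 'a \<Rightarrow> bool" where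
  "agree_from x a b \<longleftrightarrow> (\<forall>y. (x, y) \<in> r \<longrightarrow> h a y = h b y)"

lemma agree_above_sym: "agree_above x a b \<Longrightarrow> agree_above x b a"
  and agree_above_trans: "agree_above x a b \<Longrightarrow> agree_above x b c \<Longrightarrow> agree_above x a c"
  by (auto simp: agree_above_def)

lemma agree_from_conv: "x \<in> Field r \<Longrightarrow> agree_from x a b \<longleftrightarrow> agree_above x a b \<and> h a x = h b x"
  using r_refl by (auto simp: agree_above_def agree_from_def)

lemma agree_from_mono: "agree_above x a b \<Longrightarrow> (x, y) \<in> r \<Longrightarrow> x \<noteq> y \<Longrightarrow> agree_from y a b"
  unfolding agree_above_def agree_from_def using r_trans r_antisym by blast

lemma agree_above_mono: "agree_above x a b \<Longrightarrow> (x, y) \<in> r \<Longrightarrow> agree_above y a b"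
  unfolding agree_above_def using r_trans r_antisym by blast

lemma finite_has_r_max:
  assumes "finite D" "D \<noteq> {}" "D \<subseteq> Field r"
  shows "\<exists>x\<in>D. \<forall>y\<in>D. (y, x) \<in> r"
  using assms
proof (induction rule: finite_ne_induct)
  case (singleton x)
  then show ?case using r_refl by auto
next
  case (insert x F)
  then obtain m where m: "m \<in> F" "\<forall>y\<in>F. (y, m) \<in> r" by auto
  then consider "(x, m) \<in> r" | "(m, x) \<in> r" using r_total insert.prems by blast
  then show ?case
  proof cases
    case 1
    then show ?thesis using m by auto
  next
    case 2
    then show ?thesis using m r_trans r_refl insert.prems by blast
  qed
qed

lemma ex_top_difference:
  assumes "a \<in> carrier G" "b \<in> carrier G" "a \<noteq> b"
  obtains x where "x \<in> Field r" "agree_above x a b" "h a x \<noteq> h b x"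
proof -
  let ?D = "{y. h a y \<noteq> h b y}"
  have "?D \<subseteq> {y. h a y \<noteq> 0} \<union> {y. h b y \<noteq> 0}" by auto
  then have "finite ?D" using h_finite assms finite_subset by blast
  moreover have "?D \<noteq> {}" using h_inj[OF assms(1,2)] assms(3) by (auto simp: fun_eq_iff)
  moreover have D: "?D \<subseteq> Field r" using h_outside assms by (metis (mono_tags) mem_Collect_eq subsetI)
  ultimately obtain x where x: "x \<in> ?D" "\<forall>y\<in>?D. (y, x) \<in> r"
    using finite_has_r_max by blast
  then have "agree_above x a b"
    unfolding agree_above_def using r_antisym by blast
  then show thesis using that x(1) D by blast
qed

lemma gle_if_less:
  assumes "a \<in> carrier G" "b \<in> carrier G" "agree_above x a b" "h a x < h b x"
  shows "(a, b) \<in> gle G \<and> a \<noteq> b"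
proof -
  have F: "y \<in> Field r" if "h a y \<noteq> h b y" for y using h_outside assms that by metis
  have "(y, x) \<in> r" if "h a y \<noteq> h b y" for y
    using r_total[OF F[OF that] F[of x]] assms(3,4) that unfolding agree_above_def by auto
  then have "int_power_less r (h a) (h b)"
    unfolding int_power_less_def using assms(4) by blast
  then show ?thesis using gle_iff assms by auto
qed

lemma gle_top:
  assumes "(a, b) \<in> gle G" "agree_above x a b"
  shows "h a x \<le> h b x"
  using gle_if_less[OF _ _ agree_above_sym[OF assms(2)]] gle_antisym[OF assms(1)]
    gle_carrier[OF assms(1)] by fastforce

lemma agree_from_iff:
  assumes "a \<in> carrier G" "b \<in> carrier G" "x \<in> Field r"
  shows "agree_from x a b \<longleftrightarrow> a = b \<or> (\<exists>w. (w, x) \<in> r \<and> w \<noteq> x \<and> agree_above w a b)"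
proof
  assume *: "agree_from x a b"
  show "a = b \<or> (\<exists>w. (w, x) \<in> r \<and> w \<noteq> x \<and> agree_above w a b)"
  proof (cases "a = b")
    case False
    then obtain w where w: "w \<in> Field r" "agree_above w a b" "h a w \<noteq> h b w"
      using ex_top_difference assms by metis
    then have "(x, w) \<notin> r" using * by (auto simp: agree_from_def)
    then show ?thesis using w assms r_total r_refl by metis
  qed simp
qed (auto intro: agree_from_mono simp: agree_from_def[of x b b])

lemma not_agree_above_top:
  assumes "(a, b) \<in> gle G" "x \<in> Field r" "\<not> agree_above x a b"
  obtains w where "(x, w) \<in> r" "w \<noteq> x" "agree_above w a b" "h a w < h b w"
proof -
  have ab: "a \<in> carrier G" "b \<in> carrier G" "a \<noteq> b"
    using gle_carrier[OF assms(1)] assms(3) by (auto simp: agree_above_def)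
  then obtain w where w: "w \<in> Field r" "agree_above w a b" "h a w \<noteq> h b w"
    using ex_top_difference by metis
  then have "(w, x) \<notin> r" using agree_above_mono assms(3) by blast
  then have "(x, w) \<in> r" "w \<noteq> x" using r_total[OF w(1) assms(2)] assms(2) r_refl by auto
  moreover have "h a w < h b w" using gle_top[OF assms(1) w(2)] w(3) by simp
  ultimately show thesis using that w(2) by blast
qed

text \<open>
  The relation \<open>agree_above x\<close> is the equivalence generated by \<open>adjacent x\<close>, which is defined from
  the order and \<open>agree_from x\<close>, the union of the \<open>agree_above w\<close> for \<open>w < x\<close>. By induction on \<open>x\<close>
  these relations are invariant under translations, because translations preserve the order.
\<close>

definition adjacent :: "'c \<Rightarrow> 'a \<Rightarrow> 'a \<Rightarrow> bool" where
  "adjacent x a b \<longleftrightarrow> (a, b) \<in> gle G \<and>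
    (\<forall>c. (a, c) \<in> gle G \<and> (c, b) \<in> gle G \<longrightarrow> agree_from x a c \<or> agree_from x c b)"

lemma adjacent_agree_above:
  assumes "adjacent x a b" "x \<in> Field r"
  shows "agree_above x a b"
proof (rule ccontr)
  assume *: "\<not> agree_above x a b"
  have ab: "(a, b) \<in> gle G" "a \<in> carrier G" "b \<in> carrier G"
    using assms(1) gle_carrier unfolding adjacent_def by auto
  obtain w where w: "(x, w) \<in> r" "w \<noteq> x" "agree_above w a b" "h a w < h b w"
    using not_agree_above_top[OF ab(1) assms(2) *] by metis
  obtain c where c: "c \<in> carrier G" "h c = (h a)(x := h a x + 1)"
    using h_update ab assms(2) by metis
  have "(a, c) \<in> gle G"
    using gle_if_less[of a c x] ab c by (simp add: agree_above_def)
  moreover have "agree_above w c b"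
    using w(1-3) r_antisym unfolding agree_above_def c(2) by auto
  then have "(c, b) \<in> gle G"
    using gle_if_less[of c b w] w ab c by simp
  moreover have "\<not> agree_from x a c"
    using r_refl[OF assms(2)] c(2) by (auto simp: agree_from_def)
  moreover have "\<not> agree_from x c b"
  proof
    assume "agree_from x c b"
    then have "h c w = h b w" using w(1) by (simp add: agree_from_def)
    then show False using w(2,4) c(2) by simp
  qed
  ultimately show False using assms(1) unfolding adjacent_def by blast
qed

lemma adjacent_update:
  assumes "a \<in> carrier G" "c \<in> carrier G" "x \<in> Field r" "h c = (h a)(x := h a x + 1)"
  shows "adjacent x a c"
proof -
  have ac: "agree_above x a c" using assms(4) by (simp add: agree_above_def)
  have "agree_from x a d \<or> agree_from x d c" if d: "(a, d) \<in> gle G" "(d, c) \<in> gle G" for d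
  proof -
    have ad: "agree_above x a d"
    proof (rule ccontr)
      assume *: "\<not> agree_above x a d"
      obtain w where w: "(x, w) \<in> r" "w \<noteq> x" "agree_above w a d" "h a w < h d w"
        using not_agree_above_top[OF d(1) assms(3) *] by metis
      have "agree_above w d c"
        using agree_above_trans[OF agree_above_sym[OF w(3)] agree_above_mono[OF ac w(1)]] .
      then have "h d w \<le> h c w" using gle_top d(2) by blast
      then show False using w assms(4) by simp
    qed
    then have dc: "agree_above x d c" using ac agree_above_sym agree_above_trans by blast
    have "h a x \<le> h d x" "h d x \<le> h a x + 1"
      using gle_top[OF d(1) ad] gle_top[OF d(2) dc] assms(4) by simp_all
    then have "h d x = h a x \<or> h d x = h c x" using assms(4) by auto
    then show ?thesis using ad dc assms(3) by (auto simp: agree_from_conv)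
  qed
  moreover have "(a, c) \<in> gle G" using gle_if_less[of a c x] ac assms by simp
  ultimately show ?thesis by (auto simp: adjacent_def)
qed

lemma adjacent_translate:
  assumes IH: "\<And>g a b. \<lbrakk>g \<in> carrier G; a \<in> carrier G; b \<in> carrier G; agree_from x a b\<rbrakk>
      \<Longrightarrow> agree_from x (g \<otimes> a) (g \<otimes> b)"
    and g: "g \<in> carrier G" and ab: "adjacent x a b"
  shows "adjacent x (g \<otimes> a) (g \<otimes> b)"
proof -
  have car: "a \<in> carrier G" "b \<in> carrier G" and le: "(a, b) \<in> gle G"
    using ab gle_carrier by (auto simp: adjacent_def)
  have "agree_from x (g \<otimes> a) c \<or> agree_from x c (g \<otimes> b)"
    if c: "(g \<otimes> a, c) \<in> gle G" "(c, g \<otimes> b) \<in> gle G" for c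
  proof -
    define d where "d = inv g \<otimes> c"
    have cc: "c \<in> carrier G" using c gle_carrier by blast
    then have d: "d \<in> carrier G" "g \<otimes> d = c"
      using g by (simp_all add: d_def m_assoc[symmetric])
    then have "(a, d) \<in> gle G" "(d, b) \<in> gle G"
      using c car g gle_mult_left_iff by auto
    then have "agree_from x a d \<or> agree_from x d b"
      using ab unfolding adjacent_def by blast
    then show ?thesis using IH g car d by metis
  qed
  then show ?thesis using le car g gle_mult_left_iff by (simp add: adjacent_def)
qed

lemma agree_above_translate_step:
  assumes IH: "\<And>g a b. \<lbrakk>g \<in> carrier G; a \<in> carrier G; b \<in> carrier G; agree_from x a b\<rbrakk>
      \<Longrightarrow> agree_from x (g \<otimes> a) (g \<otimes> b)"
    and x: "x \<in> Field r" and g: "g \<in> carrier G"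
    and "a \<in> carrier G" "b \<in> carrier G" "agree_above x a b"
  shows "agree_above x (g \<otimes> a) (g \<otimes> b)"
proof -
  have *: "agree_above x (g \<otimes> a) (g \<otimes> b)"
    if "a \<in> carrier G" "b \<in> carrier G" "agree_above x a b" "h b x = h a x + int n" for a b n
    using that
  proof (induction n arbitrary: a)
    case 0
    then have "agree_from x a b" using x by (simp add: agree_from_conv)
    then show ?case using IH[OF g] 0 x by (simp add: agree_from_conv)
  next
    case (Suc n)
    obtain c where c: "c \<in> carrier G" "h c = (h a)(x := h a x + 1)"
      using h_update Suc.prems x by metis
    have "agree_above x (g \<otimes> a) (g \<otimes> c)"
      using adjacent_agree_above[OF adjacent_translate[OF IH g adjacent_update[OF _ c(1) x c(2)]] x]
        Suc.prems by blast
    moreover have "agree_above x (g \<otimes> c) (g \<otimes> b)"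
      using Suc.IH[OF c(1)] Suc.prems c(2) by (simp add: agree_above_def)
    ultimately show ?case by (rule agree_above_trans)
  qed
  show ?thesis
  proof (cases "h a x \<le> h b x")
    case True
    then show ?thesis using *[of a b "nat (h b x - h a x)"] assms by simp
  next
    case False
    then show ?thesis
      using *[of b a "nat (h a x - h b x)"] assms agree_above_sym by simp
  qed
qed

lemma agree_above_translate:
  assumes "x \<in> Field r" "g \<in> carrier G" "a \<in> carrier G" "b \<in> carrier G" "agree_above x a b"
  shows "agree_above x (g \<otimes> a) (g \<otimes> b)"
  using assms
proof (induction x arbitrary: g a b rule: wf_induct_rule[OF r_wf])
  case (1 x)
  have "agree_from x (g \<otimes> a) (g \<otimes> b)"
    if ab: "g \<in> carrier G" "a \<in> carrier G" "b \<in> carrier G" "agree_from x a b" for g a b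
  proof -
    consider "a = b" | w where "(w, x) \<in> r" "w \<noteq> x" "agree_above w a b"
      using agree_from_iff[OF ab(2,3) 1(2)] ab(4) by blast
    then show ?thesis
    proof cases
      case 2
      then have "agree_above w (g \<otimes> a) (g \<otimes> b)"
        using 1(1)[of w g a b] ab FieldI1 by fastforce
      then show ?thesis using 2 agree_from_mono by blast
    qed (simp add: agree_from_def)
  qed
  then show ?case using agree_above_translate_step[of x] 1(2-) by blast
qed

lemma agree_from_translate:
  assumes "x \<in> Field r" "g \<in> carrier G" "a \<in> carrier G" "b \<in> carrier G" "agree_from x a b"
  shows "agree_from x (g \<otimes> a) (g \<otimes> b)"
proof -
  consider "a = b" | w where "(w, x) \<in> r" "w \<noteq> x" "agree_above w a b"
    using assms(5) unfolding agree_from_iff[OF assms(3,4,1)] by blast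
  then show ?thesis
  proof cases
    case 2
    then have "agree_above w (g \<otimes> a) (g \<otimes> b)"
      using agree_above_translate assms FieldI1 by fast
    then show ?thesis using 2 agree_from_mono by blast
  qed (simp add: agree_from_def)
qed

definition positive :: "'a \<Rightarrow> bool" where
  "positive a \<longleftrightarrow> (\<one>, a) \<in> gle G \<and> a \<noteq> \<one>"

definition has_level :: "'a \<Rightarrow> 'c \<Rightarrow> bool" where
  "has_level a x \<longleftrightarrow> x \<in> Field r \<and> agree_above x \<one> a \<and> h \<one> x \<noteq> h a x"

lemma ex_level:
  assumes "positive a"
  shows "\<exists>x. has_level a x"
  using assms ex_top_difference[of \<one> a] gle_carrier unfolding positive_def has_level_def by metis

lemma ex_positive_of_level:
  assumes "x \<in> Field r"
  shows "\<exists>a. positive a \<and> has_level a x"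
proof -
  obtain a where a: "a \<in> carrier G" "h a = (h \<one>)(x := h \<one> x + 1)"
    using h_update[OF one_closed assms] by metis
  then show ?thesis
    using gle_if_less[of \<one> a x] assms
    by (intro exI[of _ a]) (auto simp: positive_def has_level_def agree_above_def)
qed

lemma positive_power_level:
  assumes a: "positive a" "has_level a x"
  shows "agree_above x \<one> (a [^] n) \<and> h \<one> x + int n \<le> h (a [^] n) x"
proof (induction n)
  case 0
  then show ?case by (simp add: agree_above_def)
next
  case (Suc n)
  have ac: "a \<in> carrier G" and x: "x \<in> Field r"
    using a gle_carrier by (auto simp: positive_def has_level_def)
  have gc: "a [^] n \<in> carrier G" using ac by simp
  have above: "agree_above x (a [^] n) (a [^] Suc n)"
    using agree_above_translate[OF x gc one_closed ac] a ac by (simp add: has_level_def)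
  have le: "(a [^] n, a [^] Suc n) \<in> gle G"
    using gle_mult_left_iff[OF one_closed ac gc] a ac by (simp add: positive_def)
  have "h (a [^] n) x \<noteq> h (a [^] Suc n) x"
  proof
    assume "h (a [^] n) x = h (a [^] Suc n) x"
    then have "agree_from x (a [^] n) (a [^] Suc n)" using above x by (simp add: agree_from_conv)
    then have "agree_from x (inv (a [^] n) \<otimes> a [^] n) (inv (a [^] n) \<otimes> a [^] Suc n)"
      using agree_from_translate[OF x inv_closed[OF gc] gc] ac gc by (metis nat_pow_closed)
    moreover have "inv (a [^] n) \<otimes> a [^] Suc n = a"
      using gc ac by (simp add: m_assoc[symmetric])
    ultimately have "agree_from x \<one> a" using gc by (metis l_inv)
    then show False using a x by (auto simp: agree_from_conv has_level_def)
  qed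
  then have "h (a [^] n) x < h (a [^] Suc n) x" using gle_top[OF le above] by simp
  then show ?case using Suc agree_above_trans[OF _ above, of \<one>] by simp
qed

lemma powers_below_iff:
  assumes a: "positive a" "has_level a x" and b: "positive b" "has_level b y"
  shows "(\<forall>n. (a [^] Suc n, b) \<in> gle G) \<longleftrightarrow> (x, y) \<in> r \<and> x \<noteq> y"
proof -
  have car: "a \<in> carrier G" "b \<in> carrier G" and F: "x \<in> Field r" "y \<in> Field r"
    using a b gle_carrier by (auto simp: positive_def has_level_def)
  have pc: "a [^] n \<in> carrier G" for n :: nat using car by simp
  have "(a [^] n, b) \<in> gle G" if xy: "(x, y) \<in> r" "x \<noteq> y" for n :: nat
  proof -
    have "agree_from y \<one> (a [^] n)"
      using agree_from_mono positive_power_level[OF a] xy by blast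
    then have "agree_above y (a [^] n) \<one>" "h (a [^] n) y = h \<one> y"
      using F agree_above_sym by (auto simp: agree_from_conv)
    moreover have "agree_above y \<one> b" "h \<one> y < h b y"
      using b gle_top[of \<one> b y] by (auto simp: positive_def has_level_def)
    ultimately show ?thesis
      using gle_if_less[OF pc car(2)] agree_above_trans by metis
  qed
  moreover have "(x, y) \<in> r \<and> x \<noteq> y" if le: "\<forall>n. (a [^] Suc n, b) \<in> gle G"
  proof (rule ccontr)
    assume "\<not> ?thesis"
    then have "(y, x) \<in> r" using r_total[OF F] r_refl F by auto
    moreover have "agree_above y b \<one>" using b agree_above_sym by (simp add: has_level_def)
    ultimately have bx: "agree_above x b \<one>" using agree_above_mono by blast
    define n where "n = nat (h b x - h \<one> x)"
    have "agree_above x b (a [^] Suc n)" "h b x < h (a [^] Suc n) x"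
      using positive_power_level[OF a, of "Suc n"] agree_above_trans[OF bx]
      by (auto simp: n_def split: if_splits)
    then have "(b, a [^] Suc n) \<in> gle G \<and> b \<noteq> a [^] Suc n"
      using gle_if_less[OF car(2) pc] by blast
    then show False using le gle_antisym by blast
  qed
  ultimately show ?thesis by blast
qed

end

section \<open>The limit of the approximations\<close>

definition archimedean_below :: "baire \<Rightarrow> nat \<Rightarrow> nat \<Rightarrow> bool" where
  "archimedean_below p a b \<longleftrightarrow> (\<forall>i. below p i a b)"

locale ogroup_name =
  fixes p :: baire
  assumes ordered_group_decode: "ordered_group (ogroup_decode p)"
begin

sublocale ordered_group "ogroup_decode p"
  by (rule ordered_group_decode)

lemma carrier_decode: "a \<in> carrier (ogroup_decode p) \<longleftrightarrow> el p a"
  and gle_decode: "(a, b) \<in> gle (ogroup_decode p) \<longleftrightarrow> leq p a b"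
  and mult_decode: "el p a \<Longrightarrow> el p b \<Longrightarrow> a \<otimes>\<^bsub>ogroup_decode p\<^esub> b = mul p a b"
  by (auto simp: ogroup_decode_def Let_def el_def leq_def mul_def)

lemma pow_decode:
  assumes "el p a"
  shows "pow p a i = a [^]\<^bsub>ogroup_decode p\<^esub> Suc i"
proof (induction i)
  case 0
  then show ?case using assms by (simp add: pow_def carrier_decode)
next
  case (Suc i)
  have "el p (a [^]\<^bsub>ogroup_decode p\<^esub> Suc i)"
    using nat_pow_closed[of a "Suc i"] assms by (simp only: carrier_decode)
  then have "mul p (pow p a i) a = a [^]\<^bsub>ogroup_decode p\<^esub> Suc (Suc i)"
    using assms by (simp only: Suc nat_pow_Suc mult_decode)
  then show ?case by (simp add: pow_def)
qed

lemma pos_decode: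
  "pos p a \<longleftrightarrow> (\<one>\<^bsub>ogroup_decode p\<^esub>, a) \<in> gle (ogroup_decode p) \<and> a \<noteq> \<one>\<^bsub>ogroup_decode p\<^esub>"
proof (cases "el p a")
  case True
  then have a: "a \<in> carrier (ogroup_decode p)" by (simp add: carrier_decode)
  have "leq p a (mul p a a) \<longleftrightarrow> (\<one>\<^bsub>ogroup_decode p\<^esub>, a) \<in> gle (ogroup_decode p)"
    using gle_mult_left_iff[OF one_closed a a] a True by (simp add: gle_decode mult_decode)
  moreover have "mul p a a = a \<longleftrightarrow> a = \<one>\<^bsub>ogroup_decode p\<^esub>"
    using l_cancel_one[OF a a] True by (simp add: mult_decode)
  ultimately show ?thesis using True by (simp add: pos_def)
next
  case False
  then show ?thesis using gle_carrier carrier_decode by (auto simp: pos_def)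
qed

lemma below_Suc:
  assumes "pos p a" "below p (Suc i) a b"
  shows "below p i a b"
proof -
  have a: "el p a" and ac: "a \<in> carrier (ogroup_decode p)"
    using assms(1) carrier_decode by (auto simp: pos_def)
  have "(a [^]\<^bsub>ogroup_decode p\<^esub> Suc i \<otimes>\<^bsub>ogroup_decode p\<^esub> \<one>\<^bsub>ogroup_decode p\<^esub>,
      a [^]\<^bsub>ogroup_decode p\<^esub> Suc i \<otimes>\<^bsub>ogroup_decode p\<^esub> a) \<in> gle (ogroup_decode p)"
    using assms(1) ac pos_decode gle_mult_left_iff[OF one_closed ac nat_pow_closed[OF ac, of "Suc i"]]
    by blast
  then have "(pow p a i, pow p a (Suc i)) \<in> gle (ogroup_decode p)"
    using nat_pow_closed[OF ac, of "Suc i"] by (simp add: pow_decode[OF a])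
  then show ?thesis using assms(2) gle_trans by (auto simp: below_def gle_decode)
qed

lemma eventually_below:
  assumes "pos p a"
  shows "\<forall>\<^sub>F i in sequentially. below p i a b \<longleftrightarrow> archimedean_below p a b"
proof (cases "archimedean_below p a b")
  case True
  then show ?thesis by (simp add: archimedean_below_def)
next
  case False
  then obtain k where k: "\<not> below p k a b" by (auto simp: archimedean_below_def)
  have "\<not> below p i a b" if "k \<le> i" for i
    using that by (induction rule: dec_induct) (use k below_Suc assms in auto)
  then show ?thesis using False by (auto simp: eventually_sequentially)
qed

lemma eventually_least_rep:
  "\<forall>\<^sub>F i in sequentially. least_rep p (below p i) a \<longleftrightarrow> least_rep p (archimedean_below p) a"
proof (cases "pos p a")
  case True
  have "\<forall>\<^sub>F i in sequentially. pos p b \<longrightarrow>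
      (below p i a b \<longleftrightarrow> archimedean_below p a b) \<and> (below p i b a \<longleftrightarrow> archimedean_below p b a)" for b
    using eventually_conj[OF eventually_below[OF True, of b] eventually_below[of b a]]
    by (cases "pos p b") auto
  then have "\<forall>\<^sub>F i in sequentially. \<forall>b\<in>{..<a}. pos p b \<longrightarrow>
      (below p i a b \<longleftrightarrow> archimedean_below p a b) \<and> (below p i b a \<longleftrightarrow> archimedean_below p b a)"
    by (intro eventually_ball_finite) auto
  then show ?thesis by (rule eventually_mono) (auto simp: least_rep_def)
qed (simp add: least_rep_def)

lemma eventually_stage:
  "\<forall>\<^sub>F i in sequentially. stage p (below p i) n = stage p (archimedean_below p) n"
proof -
  define a b where "a = fst (prod_decode (n div 2))" and "b = snd (prod_decode (n div 2))"
  have "\<forall>\<^sub>F i in sequentially. pos p a \<longrightarrow> (below p i a b \<longleftrightarrow> archimedean_below p a b)"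
    using eventually_below by (cases "pos p a") auto
  then show ?thesis
    using eventually_least_rep[of "n div 2"] eventually_least_rep[of a] eventually_least_rep[of b]
    by eventually_elim (auto simp: stage_def a_def[symmetric] b_def[symmetric] least_rep_def[of _ _ a])
qed

end

lemma LIMSEQ_fun_iff:
  fixes f :: "nat \<Rightarrow> 'a \<Rightarrow> 'b :: topological_space"
  shows "f \<longlonglongrightarrow> l \<longleftrightarrow> (\<forall>n. (\<lambda>i. f i n) \<longlonglongrightarrow> l n)"
  using limitin_componentwise[of "\<lambda>_. euclidean" UNIV f l sequentially]
  by (simp add: euclidean_product_topology)

lemma (in ogroup_name) LIMSEQ_stage_iff:
  "(\<lambda>i. stage p (below p i)) \<longlonglongrightarrow> q \<longleftrightarrow> q = stage p (archimedean_below p)"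
proof -
  have *: "(\<lambda>i. stage p (below p i) n) \<longlonglongrightarrow> stage p (archimedean_below p) n" for n
    using eventually_stage by (rule tendsto_eventually)
  show ?thesis
  proof
    assume "(\<lambda>i. stage p (below p i)) \<longlonglongrightarrow> q"
    then show "q = stage p (archimedean_below p)"
      unfolding LIMSEQ_fun_iff using LIMSEQ_unique[OF *] by (intro ext) metis
  qed (simp add: LIMSEQ_fun_iff *)
qed


section \<open>The limit is a copy of the exponent\<close>

lemma copy_decode_stage:
  "copy_decode (stage p B) =
    ({a. least_rep p B a}, {(a, b). least_rep p B a \<and> least_rep p B b \<and> B a b})"
  by (auto simp: copy_decode_def stage_def)

lemma strict_well_order_minus_Id:
  assumes "Well_order r"
  shows "strict_well_order (Field r, r - Id)"
  using assms unfolding strict_well_order_def strict_linear_order_on_def well_order_on_def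
    linear_order_on_def partial_order_on_def preorder_on_def
  by (auto simp: trans_diff_Id irrefl_diff_Id FieldI1 FieldI2)

lemma is_copy_dir_image:
  assumes r: "Well_order r" and \<kappa>: "inj_on \<kappa> (Field r)"
  shows "is_copy (\<kappa> ` Field r, dir_image r \<kappa> - Id) r"
proof -
  have W: "Well_order (dir_image r \<kappa>)" using r \<kappa> by (rule Well_order_dir_image)
  then have "dir_image r \<kappa> - Id \<union> Id_on (\<kappa> ` Field r) = dir_image r \<kappa>"
    unfolding dir_image_Field[symmetric] order_on_defs well_order_on_def
    by (auto simp: refl_on_def Id_on_def)
  then show ?thesis
    using strict_well_order_minus_Id[OF W] ordIso_symmetric[OF dir_image_ordIso[OF r \<kappa>]]
    by (simp add: is_copy_def dir_image_Field)
qed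

lemma (in ogroup_name) is_copy_limit:
  fixes r :: "'c rel"
  assumes r: "Well_order r" and "has_order_type_int_power (ogroup_decode p) r"
  shows "is_copy (copy_decode (stage p (archimedean_below p))) r"
proof -
  obtain h where "bij_betw h (carrier (ogroup_decode p)) (int_power r)"
    and "\<forall>a\<in>carrier (ogroup_decode p). \<forall>b\<in>carrier (ogroup_decode p).
      (a, b) \<in> gle (ogroup_decode p) \<longleftrightarrow> h a = h b \<or> int_power_less r (h a) (h b)"
    using assms(2) unfolding has_order_type_int_power_def by blast
  then interpret int_power_group "ogroup_decode p" r h
    using r by unfold_locales auto
  have pos: "pos p a \<longleftrightarrow> positive a" for a by (simp add: pos_decode positive_def)
  define lev where "lev a = (SOME x. has_level a x)" for a
  have lev: "has_level a (lev a)" if "pos p a" for a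
    using ex_level that unfolding lev_def pos by (metis someI)
  have lev_unique: "lev a = x" if "pos p a" "has_level a x" for a x
  proof -
    have "(x, lev a) \<notin> r \<or> x = lev a" "(lev a, x) \<notin> r \<or> x = lev a"
      using lev[OF that(1)] that(2) by (auto simp: has_level_def agree_above_def)
    then show ?thesis using r_total lev[OF that(1)] that(2) by (auto simp: has_level_def)
  qed
  have lev_Field: "lev a \<in> Field r" if "pos p a" for a
    using lev[OF that] by (simp add: has_level_def)
  have below: "archimedean_below p a b \<longleftrightarrow> (lev a, lev b) \<in> r \<and> lev a \<noteq> lev b"
    if "pos p a" "pos p b" for a b
  proof -
    have "el p a" using that(1) by (simp add: pos_def)
    then show ?thesis
      using powers_below_iff[OF _ lev _ lev] that
      by (simp add: pos archimedean_below_def below_def pow_decode gle_decode[symmetric]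
          del: nat_pow_Suc)
  qed
  define \<kappa> where "\<kappa> x = (LEAST a. pos p a \<and> lev a = x)" for x
  have \<kappa>: "pos p (\<kappa> x) \<and> lev (\<kappa> x) = x" if x: "x \<in> Field r" for x
  proof -
    obtain a where "pos p a" "lev a = x"
      using ex_positive_of_level[OF x] lev_unique pos by blast
    then show ?thesis
      unfolding \<kappa>_def using LeastI[of "\<lambda>a. pos p a \<and> lev a = x" a] by simp
  qed
  have \<kappa>_le: "\<kappa> (lev a) \<le> a" if "pos p a" for a
    unfolding \<kappa>_def using that by (simp add: Least_le)
  have rep: "least_rep p (archimedean_below p) a \<longleftrightarrow> pos p a \<and> \<kappa> (lev a) = a" for a
  proof (cases "pos p a")
    case True
    have "least_rep p (archimedean_below p) a \<longleftrightarrow> (\<forall>b<a. pos p b \<longrightarrow> lev a \<noteq> lev b)"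
      unfolding least_rep_def using True below r_total lev_Field by metis
    also have "\<dots> \<longleftrightarrow> \<kappa> (lev a) = a"
      using \<kappa>_le \<kappa>[OF lev_Field] True by (metis le_neq_implies_less not_le)
    finally show ?thesis using True by simp
  qed (simp add: least_rep_def)
  have range: "{a. least_rep p (archimedean_below p) a} = \<kappa> ` Field r"
    unfolding rep using \<kappa> lev_Field by force
  have inj: "inj_on \<kappa> (Field r)" using \<kappa> by (metis inj_onI)
  have "least_rep p (archimedean_below p) a \<and> least_rep p (archimedean_below p) b \<and>
      archimedean_below p a b \<longleftrightarrow> (a, b) \<in> dir_image r \<kappa> - Id" for a b
  proof
    assume *: "least_rep p (archimedean_below p) a \<and> least_rep p (archimedean_below p) b \<and>
      archimedean_below p a b"
    then have "(lev a, lev b) \<in> r" "lev a \<noteq> lev b" using below rep by auto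
    moreover have "a = \<kappa> (lev a)" "b = \<kappa> (lev b)" using * rep by auto
    ultimately show "(a, b) \<in> dir_image r \<kappa> - Id" unfolding dir_image_def by auto
  next
    assume "(a, b) \<in> dir_image r \<kappa> - Id"
    then obtain x y where "(x, y) \<in> r" "a = \<kappa> x" "b = \<kappa> y" "x \<noteq> y"
      unfolding dir_image_def by auto
    then show "least_rep p (archimedean_below p) a \<and> least_rep p (archimedean_below p) b \<and>
        archimedean_below p a b"
      using \<kappa>[of x] \<kappa>[of y] below rep FieldI1[of x y r] FieldI2[of x y r] by auto
  qed
  then have "{(a, b). least_rep p (archimedean_below p) a \<and> least_rep p (archimedean_below p) b \<and>
      archimedean_below p a b} = dir_image r \<kappa> - Id"
    by auto
  then show ?thesis
    unfolding copy_decode_stage range using is_copy_dir_image[OF r inj] by simp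
qed

theorem proposition2p30:
  shows "OG_to_alpha0 \<le>\<^sub>W lim_problem"
  unfolding weihrauch_le_def
proof (intro exI[of _ "\<lambda>p. Some (\<lambda>m.
      stage p (below p (fst (prod_decode m))) (snd (prod_decode m)))"]
    exI[of _ "\<lambda>(p, q). Some q"] conjI computable_stages computable2_snd allI impI; elim conjE)
  fix p :: baire and G
  assume "in_rep OG_to_alpha0 p = Some G" and "G \<in> problem_dom OG_to_alpha0"
  then have G: "G = ogroup_decode p" "ordered_group (ogroup_decode p)"
    and "solutions OG_to_alpha0 G \<noteq> {}"
    by (auto simp: OG_to_alpha0_def ogroup_rep_def problem_dom_def split: if_splits)
  then obtain \<alpha> :: "nat rel" where \<alpha>: "Well_order \<alpha>" "has_order_type_int_power G \<alpha>"
    by (auto simp: OG_to_alpha0_def)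
  interpret ogroup_name p using G(2) by (rule ogroup_name.intro)
  let ?s = "\<lambda>i. stage p (below p i)"
  let ?l = "stage p (archimedean_below p)"
  have copy: "is_copy (copy_decode ?l) \<alpha>" using \<alpha> G(1) is_copy_limit by simp
  moreover have "?l n \<in> {0, 1}" for n by (simp add: stage_def)
  ultimately have rep: "copy_rep ?l = Some (copy_decode ?l)"
    by (auto simp: copy_rep_def is_copy_def)
  have "copy_decode ?l \<in> solutions OG_to_alpha0 G"
    using \<alpha> copy by (auto simp: OG_to_alpha0_def)
  moreover have "?s \<in> problem_dom lim_problem"
  proof -
    have "in_rep lim_problem (\<lambda>m. ?s (fst (prod_decode m)) (snd (prod_decode m))) = Some ?s"
      by (simp add: lim_problem_def)
    moreover have "?l \<in> solutions lim_problem ?s"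
      using LIMSEQ_stage_iff[of ?l] by (simp add: lim_problem_def)
    ultimately show ?thesis unfolding problem_dom_def by (auto intro: ranI)
  qed
  ultimately show "\<exists>p' z. Some (\<lambda>m. ?s (fst (prod_decode m)) (snd (prod_decode m))) = Some p' \<and>
      in_rep lim_problem p' = Some z \<and> z \<in> problem_dom lim_problem \<and>
      (\<forall>q y. out_rep lim_problem q = Some y \<and> y \<in> solutions lim_problem z \<longrightarrow>
        (\<exists>r w. (case (p, q) of (p, q) \<Rightarrow> Some q) = Some r \<and> out_rep OG_to_alpha0 r = Some w \<and>
          w \<in> solutions OG_to_alpha0 G))"
    using rep LIMSEQ_stage_iff
    by (intro exI[of _ "\<lambda>m. ?s (fst (prod_decode m)) (snd (prod_decode m))"] exI[of _ ?s])
      (simp add: lim_problem_def OG_to_alpha0_def del: split_paired_Ex)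
qed

end
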